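(* Let $f:\mathcal H\to\mathcal H$ satisfy $\mathrm{Re}\,\langle v-w,f(v)-f(w)\rangle_{\mathcal H}\le \ell\,\|v-w\|_{\mathcal H}^2$ and $\|f(v)-f(w)\|_{\mathcal H}\le L\,\|v-w\|_{\mathcal H}$ for all $v,w\in\mathcal H$. Let $y$ be a solution of $\dot y=f(y)$ on $[0,\bar t]$, let $u(t)=\Phi(\theta(t))$ be the regularized dynamical parametric approximation, and let $\bar\delta_\rho(t)$ be the approximability quantity defined in the context. Then $$\|u(t)-y(t)\|_{\mathcal H}\le e^{(\ell+L)t}\,\|u(0)-y(0)\|_{\mathcal H}+e^{(\ell+L)t}\int_0^t\bar\delta_\rho(s)\,ds$$ for $0\le t\le\bar t$, as long as this bound (the right-hand side) does not exceed $\rho$.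
   Context: $\mathcal H$ is a (real or complex) Hilbert space, $\mathcal Q$ a finite-dimensional inner product space, $\Phi:\mathcal Q\to\mathcal H$ twice continuously differentiable (possibly non-injective, with $\Phi'(\theta)$ possibly rank deficient). $\varepsilon=\varepsilon(t)>0$ is a (continuous) regularization parameter function. Regularized dynamical parametric approximation: $u(t)=\Phi(\theta(t))$, where $\theta:[0,\bar t]\to\mathcal Q$ is continuously differentiable and for every $t$ the derivative $\dot\theta(t)$ is the unique minimizer such that $\delta(t)^2:=\|\Phi'(\theta(t))\dot\theta(t)-f(u(t))\|_{\mathcal H}^2+\varepsilon(t)^2\|\dot\theta(t)\|_{\mathcal Q}^2$ is minimal. Approximability quantity: fix $\rho>0$ such that for every $t\le\bar t$ there exists $\theta\in\mathcal Q$ with $\|\Phi(\theta)-y(t)\|_{\mathcal H}\le\rho$, and define $\bar\delta_\rho(t)\ge 0$ by $$\bar\delta_\rho(t)^2:=\sup_{\theta\in\mathcal Q:\ \|\Phi(\theta)-y(t)\|_{\mathcal H}\le\rho}\ \min_{\dot\theta\in\mathcal Q}\Bigl(\|\Phi'(\theta)\dot\theta-\dot y(t)\|_{\mathcal H}^2+\varepsilon(t)^2\|\dot\theta\|_{\mathcal Q}^2\Bigr).$$ It is understood that $\bar\delta_\rho$ is integrable on $[0,\bar t]$. *)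

theory Defs
  imports "HOL-Analysis.Analysis"
begin

text \<open>
  Inner product spaces over the real or the complex numbers. Both \<^typ>\<open>real\<close> and
  \<^typ>\<open>complex\<close> are of sort \<open>{real_normed_field, real_inner}\<close>, and up to isomorphism
  they are the only such fields. The inner product with \<open>1\<close> is then the real part; see the
  lemmas below for the two instances.
\<close>

definition scalar_Re :: "'k::{real_normed_field,real_inner} \<Rightarrow> real" where
  "scalar_Re z = inner z 1"

definition scalar_cnj :: "'k::{real_normed_field,real_inner} \<Rightarrow> 'k" where
  "scalar_cnj z = of_real (2 * scalar_Re z) - z"

lemma scalar_Re_real [simp]: "scalar_Re (x::real) = x"
  by (simp add: scalar_Re_def)

lemma scalar_Re_complex [simp]: "scalar_Re (z::complex) = Re z"
  by (simp add: scalar_Re_def inner_complex_def)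

lemma scalar_cnj_real [simp]: "scalar_cnj (x::real) = x"
  by (simp add: scalar_cnj_def)

lemma scalar_cnj_complex [simp]: "scalar_cnj (z::complex) = cnj z"
  by (simp add: scalar_cnj_def complex_eq_iff)

text \<open>
  The real normed structure of the underlying type is required to be the one induced by the
  scalar multiplication and the inner product; completeness is expressed by the sort
  \<^class>\<open>banach\<close>. The inner product is antilinear in its first argument.
\<close>

locale inner_product_space = vector_space scale
  for scale :: "'k::{real_normed_field,real_inner} \<Rightarrow> 'a::real_normed_vector \<Rightarrow> 'a" +
  fixes ip :: "'a \<Rightarrow> 'a \<Rightarrow> 'k"
  assumes scale_of_real: "scale (of_real r) x = r *\<^sub>R x"
    and ip_cnj: "ip y x = scalar_cnj (ip x y)"
    and ip_add_right: "ip x (y + z) = ip x y + ip x z"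
    and ip_scale_right: "ip x (scale c y) = c * ip x y"
    and ip_self: "ip x x = of_real ((norm x)\<^sup>2)"

locale finite_dim_inner_product_space = inner_product_space +
  assumes finite_dim: "\<exists>B. finite B \<and> span B = UNIV"

locale hilbert_space = inner_product_space scale ip
  for scale :: "'k::{real_normed_field,real_inner} \<Rightarrow> 'a::banach \<Rightarrow> 'a"
    and ip :: "'a \<Rightarrow> 'a \<Rightarrow> 'k"

lemma inner_product_space_real:
  "inner_product_space (scaleR :: real \<Rightarrow> 'a::real_inner \<Rightarrow> 'a) inner"
  by unfold_locales (simp_all add: algebra_simps inner_commute inner_add_right dot_square_norm)

lemma hilbert_space_complex:
  "hilbert_space ((*) :: complex \<Rightarrow> complex \<Rightarrow> complex) (\<lambda>z w. cnj z * w)"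
  by unfold_locales
    (simp_all add: algebra_simps scaleR_conv_of_real complex_norm_square del: of_real_power)

text \<open>
  Differentiability is over the reals, also when both spaces are complex: this includes complex
  differentiable maps, whose derivative is the same linear map.
\<close>

definition twice_continuously_differentiable ::
  "('q::real_normed_vector \<Rightarrow> 'h::real_normed_vector) \<Rightarrow> ('q \<Rightarrow> 'q \<Rightarrow>\<^sub>L 'h) \<Rightarrow> bool" where
  "twice_continuously_differentiable \<Phi> \<Phi>' \<longleftrightarrow>
     (\<forall>\<theta>. (\<Phi> has_derivative blinfun_apply (\<Phi>' \<theta>)) (at \<theta>)) \<and>
     (\<exists>\<Phi>'' :: 'q \<Rightarrow> 'q \<Rightarrow>\<^sub>L 'q \<Rightarrow>\<^sub>L 'h.
        (\<forall>\<theta>. (\<Phi>' has_derivative blinfun_apply (\<Phi>'' \<theta>)) (at \<theta>)) \<and> continuous_on UNIV \<Phi>'')"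

definition regularized_residual ::
  "('q::real_normed_vector \<Rightarrow>\<^sub>L 'h::real_normed_vector) \<Rightarrow> 'h \<Rightarrow> real \<Rightarrow> 'q \<Rightarrow> real" where
  "regularized_residual A g e \<eta> = (norm (blinfun_apply A \<eta> - g))\<^sup>2 + e\<^sup>2 * (norm \<eta>)\<^sup>2"

definition unique_minimizer :: "('q \<Rightarrow> real) \<Rightarrow> 'q \<Rightarrow> bool" where
  "unique_minimizer F \<eta> \<longleftrightarrow> (\<forall>\<zeta>. \<zeta> \<noteq> \<eta> \<longrightarrow> F \<eta> < F \<zeta>)"

text \<open>The approximation itself is \<open>u t = \<Phi> (\<theta> t)\<close>.\<close>

definition regularized_dynamical_approximation ::
  "('q::real_normed_vector \<Rightarrow> 'h::real_normed_vector) \<Rightarrow> ('q \<Rightarrow> 'q \<Rightarrow>\<^sub>L 'h) \<Rightarrow>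
   ('h \<Rightarrow> 'h) \<Rightarrow> (real \<Rightarrow> real) \<Rightarrow> real \<Rightarrow> (real \<Rightarrow> 'q) \<Rightarrow> bool" where
  "regularized_dynamical_approximation \<Phi> \<Phi>' f \<epsilon> T \<theta> \<longleftrightarrow>
     (\<exists>\<theta>'. continuous_on {0..T} \<theta>' \<and>
        (\<forall>t\<in>{0..T}. (\<theta> has_vector_derivative \<theta>' t) (at t within {0..T}) \<and>
           unique_minimizer (regularized_residual (\<Phi>' (\<theta> t)) (f (\<Phi> (\<theta> t))) (\<epsilon> t)) (\<theta>' t)))"

text \<open>
  The infimum is a minimum when \<open>\<epsilon> t > 0\<close> and \<open>'q\<close> is finite-dimensional (the residual is
  continuous and coercive). The supremum is over a set bounded by \<open>(norm (y' t))\<^sup>2\<close>, which is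
  nonempty whenever some \<open>\<Phi> \<theta>\<close> lies within \<open>\<rho>\<close> of \<open>y t\<close>, so that the conditionally
  complete operators on the reals take their intended values.
\<close>

definition approximability ::
  "('q::real_normed_vector \<Rightarrow> 'h::real_normed_vector) \<Rightarrow> ('q \<Rightarrow> 'q \<Rightarrow>\<^sub>L 'h) \<Rightarrow>
   (real \<Rightarrow> real) \<Rightarrow> (real \<Rightarrow> 'h) \<Rightarrow> (real \<Rightarrow> 'h) \<Rightarrow> real \<Rightarrow> real \<Rightarrow> real" where
  "approximability \<Phi> \<Phi>' \<epsilon> y y' \<rho> t =
     sqrt (SUP \<theta>\<in>{\<theta>. norm (\<Phi> \<theta> - y t) \<le> \<rho>}.
             INF \<eta>. regularized_residual (\<Phi>' \<theta>) (y' t) (\<epsilon> t) \<eta>)"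

lemma regularized_residual_bdd_below: "bdd_below (range (regularized_residual A g e))"
  by (rule bdd_belowI[where m = 0]) (auto simp: regularized_residual_def)

lemma INF_regularized_residual_le: "(INF \<eta>. regularized_residual A g e \<eta>) \<le> (norm g)\<^sup>2"
  using cINF_lower[OF regularized_residual_bdd_below, of 0 A g e]
  by (simp add: regularized_residual_def blinfun.zero_right)

end

theory Submission
  imports Defs
begin

text \<open>
  For \<open>e = u - y\<close> the one-sided Lipschitz condition gives
  \<open>\<parallel>e\<parallel>' \<le> l \<parallel>e\<parallel> + \<delta>\<close>, and minimality of \<open>\<theta>'\<close>, with \<open>f u\<close> replaced by \<open>f y\<close>,
  gives \<open>\<delta> \<le> \<delta>\<^sub>\<rho> + L \<parallel>e\<parallel>\<close> as long as \<open>\<parallel>e\<parallel> \<le> \<rho>\<close>; Gronwall's inequality then yields the bound.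
  That \<open>\<parallel>e\<parallel> \<le> \<rho>\<close> persists is only delicate if \<open>\<parallel>e\<parallel>\<close> reaches \<open>\<rho>\<close> at a time \<open>m < t\<close>. Since
  the bound is nondecreasing and at most \<open>\<rho>\<close>, it is then constant on \<open>[m, t]\<close>, so
  \<open>\<delta>\<^sub>\<rho> = 0\<close> almost everywhere there. But \<open>\<delta>\<^sub>\<rho> = 0\<close> forces \<open>f y = 0\<close>, and comparing \<open>\<theta>'\<close> with
  \<open>0\<close> yields \<open>\<delta> \<le> \<parallel>f u\<parallel> \<le> L \<parallel>e\<parallel>\<close> irrespective of \<open>\<rho>\<close>.
\<close>

section \<open>Real parts of scalars and the real inner product they induce\<close>

lemma scalar_Re_add: "scalar_Re (a + b) = scalar_Re a + scalar_Re b"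
  by (simp add: scalar_Re_def inner_add_left)

lemma scalar_Re_of_real_mult: "scalar_Re (of_real r * a) = r * scalar_Re a"
  by (simp add: scalar_Re_def flip: scaleR_conv_of_real)

lemma scalar_Re_of_real: "scalar_Re (of_real r) = r"
  by (simp add: scalar_Re_def of_real_def dot_square_norm)

lemma scalar_Re_cnj:
  fixes a :: "'k::{real_normed_field,real_inner}"
  shows "scalar_Re (scalar_cnj a) = scalar_Re a"
proof -
  have "scalar_Re (scalar_cnj a) = scalar_Re (of_real (2 * scalar_Re a) :: 'k) - scalar_Re a"
    by (simp only: scalar_cnj_def scalar_Re_def inner_diff_left)
  then show ?thesis
    by (simp only: scalar_Re_of_real)
qed

context inner_product_space
begin

text \<open>The underlying real inner product, inducing the same norm; it lets real and complex
  spaces be treated at once.\<close>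

definition re_ip :: "'a \<Rightarrow> 'a \<Rightarrow> real" where
  "re_ip x y = scalar_Re (ip x y)"

lemma re_ip_commute: "re_ip x y = re_ip y x"
  unfolding re_ip_def by (metis ip_cnj scalar_Re_cnj)

lemma re_ip_add_right: "re_ip x (y + z) = re_ip x y + re_ip x z"
  by (simp add: re_ip_def ip_add_right scalar_Re_add)

lemma re_ip_scaleR_right: "re_ip x (r *\<^sub>R y) = r * re_ip x y"
  by (metis re_ip_def ip_scale_right scale_of_real scalar_Re_of_real_mult)

lemma re_ip_add_left: "re_ip (y + z) x = re_ip y x + re_ip z x"
  by (metis re_ip_add_right re_ip_commute)

lemma re_ip_scaleR_left: "re_ip (r *\<^sub>R y) x = r * re_ip y x"
  by (metis re_ip_scaleR_right re_ip_commute)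

lemma re_ip_minus_right: "re_ip x (- y) = - re_ip x y"
  using re_ip_scaleR_right[of x "- 1" y] by simp

lemma re_ip_self: "re_ip x x = (norm x)\<^sup>2"
  by (simp only: re_ip_def ip_self scalar_Re_of_real)

text \<open>Cauchy-Schwarz: for nonzero vectors, expand the squared norm of
  \<open>norm y *\<^sub>R x - norm x *\<^sub>R y\<close> and cancel the positive factor
  \<open>2 * (norm x * norm y)\<close>.\<close>

lemma re_ip_le: "re_ip x y \<le> norm x * norm y"
proof (cases "x = 0 \<or> y = 0")
  case True
  then show ?thesis
    using re_ip_scaleR_right[of x 0 y] re_ip_scaleR_left[of 0 x y]
      re_ip_scaleR_right[of x 0 x] re_ip_scaleR_left[of 0 x y] by auto
next
  case False
  let ?z = "norm y *\<^sub>R x + (- norm x) *\<^sub>R y"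
  have "re_ip ?z ?z = 2 * (norm x * norm y) * (norm x * norm y - re_ip x y)"
    unfolding re_ip_add_left re_ip_add_right re_ip_scaleR_left re_ip_scaleR_right
    by (simp add: re_ip_self re_ip_commute[of y x] power2_eq_square algebra_simps)
  then have "0 \<le> 2 * (norm x * norm y) * (norm x * norm y - re_ip x y)"
    by (metis re_ip_self zero_le_power2)
  moreover have "0 < 2 * (norm x * norm y)"
    using False by simp
  ultimately show ?thesis
    by (simp only: zero_le_mult_iff) linarith
qed

lemma abs_re_ip_le: "\<bar>re_ip x y\<bar> \<le> norm x * norm y"
  using re_ip_le[of x y] re_ip_le[of x "- y"] by (simp add: re_ip_minus_right abs_le_iff)

text \<open>Supplies the product rule for differentiating \<open>re_ip (e s) (e s)\<close>.\<close>

lemma bounded_bilinear_re_ip: "bounded_bilinear re_ip"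
  by (rule bounded_bilinear.intro)
    (auto simp: re_ip_add_left re_ip_add_right re_ip_scaleR_left re_ip_scaleR_right
      intro!: exI[of _ 1] abs_re_ip_le)

text \<open>
  The norm is not differentiable at \<open>0\<close>, so we apply the fundamental theorem of calculus to
  \<open>exp (- \<kappa> s) * sqrt (\<parallel>e s\<parallel>\<^sup>2 + \<mu>\<^sup>2)\<close> and let \<open>\<mu>\<close> tend to \<open>0\<close>.
\<close>

lemma norm_gronwall:
  fixes e e' :: "real \<Rightarrow> 'a" and g :: "real \<Rightarrow> real"
  assumes "0 \<le> a" "a \<le> b" "0 \<le> \<kappa>"
    and deriv: "\<And>s. s \<in> {a..b} \<Longrightarrow> (e has_vector_derivative e' s) (at s within {a..b})"
    and N: "negligible N"
    and le: "\<And>s. s \<in> {a..b} - N \<Longrightarrow> re_ip (e s) (e' s) \<le> \<kappa> * (norm (e s))\<^sup>2 + g s * norm (e s)"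
    and g: "g integrable_on {a..b}"
    and g_nonneg: "\<And>s. s \<in> {a..b} \<Longrightarrow> 0 \<le> g s"
  shows "exp (- \<kappa> * b) * norm (e b) \<le> exp (- \<kappa> * a) * norm (e a) + integral {a..b} g"
proof (rule field_le_epsilon)
  fix \<mu> :: real
  assume \<mu>: "0 < \<mu>"
  define w where "w s = sqrt (re_ip (e s) (e s) + \<mu>\<^sup>2)" for s
  define x' where "x' s = exp (- \<kappa> * s) * (re_ip (e s) (e' s) / w s - \<kappa> * w s)" for s
  have w2: "(w s)\<^sup>2 = (norm (e s))\<^sup>2 + \<mu>\<^sup>2" for s
    by (simp add: w_def re_ip_self)
  have w_pos: "0 < w s" for s
    using \<mu> by (simp add: w_def re_ip_self add_nonneg_pos)
  have w_ge: "norm (e s) \<le> w s" for s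
    by (simp add: w_def re_ip_self)
  have w_le: "w s \<le> norm (e s) + \<mu>" for s
    unfolding w_def re_ip_self using sqrt_add_le_add_sqrt[of "(norm (e s))\<^sup>2" "\<mu>\<^sup>2"] \<mu> by simp
  have w_deriv: "(w has_real_derivative re_ip (e s) (e' s) / w s) (at s within {a..b})"
    if s: "s \<in> {a..b}" for s
  proof -
    have "((\<lambda>s. re_ip (e s) (e s)) has_real_derivative 2 * re_ip (e s) (e' s)) (at s within {a..b})"
      using bounded_bilinear.has_vector_derivative[OF bounded_bilinear_re_ip deriv[OF s] deriv[OF s]]
      by (simp add: has_real_derivative_iff_has_vector_derivative re_ip_commute[of "e' s"])
    moreover have "0 < re_ip (e s) (e s) + \<mu>\<^sup>2"
      using \<mu> by (simp add: re_ip_self add_nonneg_pos)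
    ultimately show ?thesis
      unfolding w_def[abs_def]
      by (auto intro!: derivative_eq_intros simp: inverse_eq_divide)
  qed
  have "((\<lambda>s. exp (- \<kappa> * s) * w s) has_vector_derivative x' s) (at s within {a..b})"
    if s: "s \<in> {a..b}" for s
  proof -
    have "((\<lambda>s. exp (- \<kappa> * s)) has_real_derivative - \<kappa> * exp (- \<kappa> * s)) (at s within {a..b})"
      by (auto intro!: derivative_eq_intros)
    from DERIV_mult[OF this w_deriv[OF s]] show ?thesis
      by (simp add: x'_def algebra_simps has_real_derivative_iff_has_vector_derivative)
  qed
  then have "(x' has_integral exp (- \<kappa> * b) * w b - exp (- \<kappa> * a) * w a) {a..b}"
    using \<open>a \<le> b\<close> by (rule fundamental_theorem_of_calculus[rotated])
  \<comment> \<open>The growth bound is only known off \<open>N\<close>. Overwriting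
    \<open>x'\<close> by \<open>0\<close> there keeps the integral, and \<open>0 \<le> g\<close>
    makes the pointwise comparison hold everywhere.\<close>
  then have "((\<lambda>s. if s \<in> N then 0 else x' s) has_integral
      exp (- \<kappa> * b) * w b - exp (- \<kappa> * a) * w a) {a..b}"
    by (rule has_integral_spike[OF N, rotated]) simp
  moreover have "(if s \<in> N then 0 else x' s) \<le> g s" if s: "s \<in> {a..b}" for s
  proof (cases "s \<in> N")
    case False
    have "re_ip (e s) (e' s) \<le> \<kappa> * (norm (e s))\<^sup>2 + g s * norm (e s)"
      using le s False by blast
    also have "\<dots> \<le> \<kappa> * (w s)\<^sup>2 + g s * w s"
      using \<open>0 \<le> \<kappa>\<close> g_nonneg[OF s] w_ge[of s]
      by (intro add_mono mult_left_mono power_mono) auto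
    also have "\<dots> = (\<kappa> * w s + g s) * w s"
      by (simp add: algebra_simps power2_eq_square)
    finally have "re_ip (e s) (e' s) / w s \<le> \<kappa> * w s + g s"
      unfolding pos_divide_le_eq[OF w_pos] .
    then have "re_ip (e s) (e' s) / w s - \<kappa> * w s \<le> g s"
      by simp
    then have "x' s \<le> exp (- \<kappa> * s) * g s"
      unfolding x'_def by (rule mult_left_mono) simp
    \<comment> \<open>Dropping the weight \<open>exp (- \<kappa> * s)\<close> is what puts the full
      factor \<open>exp (\<kappa> * b)\<close> in front of the integral in the final bound.\<close>
    also have "\<dots> \<le> g s"
      using \<open>0 \<le> \<kappa>\<close> \<open>0 \<le> a\<close> s g_nonneg[OF s] by (intro mult_left_le_one_le) auto
    finally show ?thesis
      using False by simp
  qed (use g_nonneg s in simp)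
  ultimately have "exp (- \<kappa> * b) * w b - exp (- \<kappa> * a) * w a \<le> integral {a..b} g"
    using has_integral_le[OF _ integrable_integral[OF g]] by blast
  moreover have "exp (- \<kappa> * b) * norm (e b) \<le> exp (- \<kappa> * b) * w b"
    using w_ge by simp
  moreover have "exp (- \<kappa> * a) * w a \<le> exp (- \<kappa> * a) * (norm (e a) + \<mu>)"
    using w_le by simp
  moreover have "exp (- \<kappa> * a) * \<mu> \<le> \<mu>"
    using \<open>0 \<le> \<kappa>\<close> \<open>0 \<le> a\<close> \<mu> by (intro mult_left_le_one_le) auto
  ultimately show "exp (- \<kappa> * b) * norm (e b)
      \<le> exp (- \<kappa> * a) * norm (e a) + integral {a..b} g + \<mu>"
    unfolding distrib_left by linarith
qed

end

section \<open>Regularized residuals and the approximability quantity\<close>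

lemma regularized_residual_nonneg: "0 \<le> regularized_residual A g e \<eta>"
  by (simp add: regularized_residual_def)

text \<open>Views the residual as a squared norm in the product space, so that changing
  \<open>g\<close> is controlled by the triangle inequality.\<close>

lemma sqrt_regularized_residual:
  "sqrt (regularized_residual A g e \<eta>) = norm (blinfun_apply A \<eta> - g, e *\<^sub>R \<eta>)"
  by (simp add: regularized_residual_def norm_Pair power_mult_distrib)

lemma sqrt_regularized_residual_le:
  "sqrt (regularized_residual A g e \<eta>) \<le> sqrt (regularized_residual A g' e \<eta>) + norm (g - g')"
proof -
  have "(blinfun_apply A \<eta> - g, e *\<^sub>R \<eta>) = (blinfun_apply A \<eta> - g', e *\<^sub>R \<eta>) + (g' - g, 0)"
    by simp
  then show ?thesis
    unfolding sqrt_regularized_residual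
    using norm_triangle_ineq[of "(blinfun_apply A \<eta> - g', e *\<^sub>R \<eta>)" "(g' - g, 0)"]
    by (simp add: norm_Pair norm_minus_commute)
qed

lemma INF_regularized_residual_nonneg: "0 \<le> (INF \<eta>. regularized_residual A g e \<eta>)"
  by (rule cINF_greatest) (auto simp: regularized_residual_nonneg)

text \<open>Carries a bound uniform in \<open>\<eta>\<close> over to the infimum. The sign of
  \<open>d\<close> is split because squaring preserves the inequality only for nonnegative
  \<open>d\<close>.\<close>

lemma sqrt_INF_regularized_residual_ge:
  assumes "\<And>\<eta>. d \<le> sqrt (regularized_residual A g e \<eta>)"
  shows "d \<le> sqrt (INF \<eta>. regularized_residual A g e \<eta>)"
proof (cases "d \<le> 0")
  case True
  then show ?thesis
    by (rule order_trans) (simp add: INF_regularized_residual_nonneg)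
next
  case False
  then have "d\<^sup>2 \<le> regularized_residual A g e \<eta>" for \<eta>
    using power_mono[OF assms[of \<eta>], of 2] by (simp add: regularized_residual_nonneg)
  then have "d\<^sup>2 \<le> (INF \<eta>. regularized_residual A g e \<eta>)"
    by (intro cINF_greatest) auto
  then show ?thesis
    by (rule real_le_rsqrt)
qed

text \<open>Both \<open>A \<eta> - g\<close> and \<open>e *\<^sub>R \<eta>\<close> are bounded by
  the root of the residual, and \<open>e > 0\<close> lets the latter control
  \<open>A \<eta>\<close>. The constant does not depend on \<open>\<eta>\<close>, so a zero infimum
  forces \<open>g = 0\<close>.\<close>

lemma norm_le_regularized_residual:
  assumes "0 < e"
  shows "norm g \<le> (1 + norm A / e) * sqrt (regularized_residual A g e \<eta>)"
proof -
  have "norm g \<le> norm (blinfun_apply A \<eta>) + norm (blinfun_apply A \<eta> - g)"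
    using norm_triangle_sub[of g "blinfun_apply A \<eta>"] by (simp add: norm_minus_commute)
  moreover have "norm (blinfun_apply A \<eta>) \<le> norm A / e * norm (e *\<^sub>R \<eta>)"
    using assms norm_blinfun[of A \<eta>] by simp
  moreover have "norm A / e * norm (e *\<^sub>R \<eta>)
      \<le> norm A / e * sqrt (regularized_residual A g e \<eta>)"
    unfolding sqrt_regularized_residual using assms
    by (intro mult_left_mono norm_snd_le) simp
  moreover have "norm (blinfun_apply A \<eta> - g) \<le> sqrt (regularized_residual A g e \<eta>)"
    unfolding sqrt_regularized_residual by (rule norm_fst_le)
  ultimately show ?thesis
    by (simp add: distrib_right)
qed

lemma sqrt_INF_le_approximability:
  assumes "norm (\<Phi> \<theta> - y s) \<le> \<rho>"
  shows "sqrt (INF \<eta>. regularized_residual (\<Phi>' \<theta>) (y' s) (\<epsilon> s) \<eta>)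
    \<le> approximability \<Phi> \<Phi>' \<epsilon> y y' \<rho> s"
  unfolding approximability_def real_sqrt_le_iff
  by (rule cSUP_upper)
    (use assms in \<open>auto intro!: bdd_aboveI2[where M = "(norm (y' s))\<^sup>2"] INF_regularized_residual_le\<close>)

lemma approximability_nonneg:
  assumes "norm (\<Phi> \<theta> - y s) \<le> \<rho>"
  shows "0 \<le> approximability \<Phi> \<Phi>' \<epsilon> y y' \<rho> s"
proof -
  have "0 \<le> sqrt (INF \<eta>. regularized_residual (\<Phi>' \<theta>) (y' s) (\<epsilon> s) \<eta>)"
    by (simp add: INF_regularized_residual_nonneg)
  also have "\<dots> \<le> approximability \<Phi> \<Phi>' \<epsilon> y y' \<rho> s"
    using assms by (rule sqrt_INF_le_approximability)
  finally show ?thesis .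
qed

lemma approximability_eq_0_imp:
  assumes "norm (\<Phi> \<theta> - y s) \<le> \<rho>" "approximability \<Phi> \<Phi>' \<epsilon> y y' \<rho> s = 0" "0 < \<epsilon> s"
  shows "y' s = 0"
proof -
  let ?K = "1 + norm (\<Phi>' \<theta>) / \<epsilon> s"
  have K: "0 < ?K"
    using assms(3) by (simp add: add_pos_nonneg)
  have "norm (y' s) / ?K \<le> sqrt (regularized_residual (\<Phi>' \<theta>) (y' s) (\<epsilon> s) \<eta>)" for \<eta>
    using norm_le_regularized_residual[OF assms(3), of "y' s" "\<Phi>' \<theta>" \<eta>] K
    by (simp add: pos_divide_le_eq mult.commute)
  then have "norm (y' s) / ?K \<le> sqrt (INF \<eta>. regularized_residual (\<Phi>' \<theta>) (y' s) (\<epsilon> s) \<eta>)"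
    by (rule sqrt_INF_regularized_residual_ge)
  also have "\<dots> \<le> 0"
    using sqrt_INF_le_approximability[where \<Phi> = \<Phi> and y = y and s = s, OF assms(1), of \<Phi>' y' \<epsilon>] assms(2)
    by simp
  finally have "norm (y' s) \<le> 0 * ?K"
    unfolding pos_divide_le_eq[OF K] .
  then show ?thesis
    by simp
qed

text \<open>Inside the ball, the minimizer is compared with every \<open>\<zeta>\<close>, and
  \<open>g\<close> is exchanged for \<open>y' s\<close> at the cost of their distance. If the
  approximability vanishes, \<open>\<theta>\<close> may lie outside the ball:
  \<open>\<theta>\<^sub>0\<close> yields \<open>y' s = 0\<close>, and comparison with
  \<open>0\<close> suffices.\<close>

lemma minimal_residual_le:
  assumes min: "unique_minimizer (regularized_residual (\<Phi>' \<theta>) g (\<epsilon> s)) \<eta>"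
    and "0 < \<epsilon> s" "norm (\<Phi> \<theta>\<^sub>0 - y s) \<le> \<rho>"
    and "norm (\<Phi> \<theta> - y s) \<le> \<rho> \<or> approximability \<Phi> \<Phi>' \<epsilon> y y' \<rho> s = 0"
  shows "norm (blinfun_apply (\<Phi>' \<theta>) \<eta> - g)
    \<le> approximability \<Phi> \<Phi>' \<epsilon> y y' \<rho> s + norm (g - y' s)"
proof -
  let ?R = "regularized_residual (\<Phi>' \<theta>) g (\<epsilon> s)"
  have R: "sqrt (?R \<eta>) \<le> sqrt (?R \<zeta>)" for \<zeta>
    using min unfolding unique_minimizer_def by (metis less_imp_le order_refl real_sqrt_le_iff)
  have "norm (blinfun_apply (\<Phi>' \<theta>) \<eta> - g) \<le> sqrt (?R \<eta>)"
    unfolding sqrt_regularized_residual by (rule norm_fst_le)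
  also have "\<dots> \<le> approximability \<Phi> \<Phi>' \<epsilon> y y' \<rho> s + norm (g - y' s)"
    using assms(4)
  proof
    assume in_ball: "norm (\<Phi> \<theta> - y s) \<le> \<rho>"
    have "sqrt (?R \<eta>) - norm (g - y' s) \<le> sqrt (regularized_residual (\<Phi>' \<theta>) (y' s) (\<epsilon> s) \<zeta>)" for \<zeta>
      using R[of \<zeta>] sqrt_regularized_residual_le[of "\<Phi>' \<theta>" g "\<epsilon> s" \<zeta> "y' s"] by linarith
    then have "sqrt (?R \<eta>) - norm (g - y' s)
        \<le> sqrt (INF \<zeta>. regularized_residual (\<Phi>' \<theta>) (y' s) (\<epsilon> s) \<zeta>)"
      by (rule sqrt_INF_regularized_residual_ge)
    with sqrt_INF_le_approximability[where \<Phi> = \<Phi> and y = y and s = s, OF in_ball, of \<Phi>' y' \<epsilon>]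
    show ?thesis
      by linarith
  next
    assume zero: "approximability \<Phi> \<Phi>' \<epsilon> y y' \<rho> s = 0"
    then have "y' s = 0"
      using assms(2,3) by (rule_tac approximability_eq_0_imp)
    with zero R[of 0] show ?thesis
      by (simp add: regularized_residual_def)
  qed
  finally show ?thesis .
qed

text \<open>A nonnegative gauge-integrable function is Lebesgue integrable, so the almost-everywhere
  criterion for a zero Lebesgue integral applies.\<close>

lemma negligible_nonzero_set_if_integral_eq_0:
  fixes g :: "'a::euclidean_space \<Rightarrow> real"
  assumes "g integrable_on S" "\<And>x. x \<in> S \<Longrightarrow> 0 \<le> g x" "integral S g = 0"
  shows "negligible {x \<in> S. g x \<noteq> 0}"
proof -
  have g: "set_integrable lebesgue S g"
    using assms(1,2) by (rule nonnegative_absolutely_integrable_1)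
  have "(LINT x|lebesgue. indicat_real S x *\<^sub>R g x) = 0"
    using set_lebesgue_integral_eq_integral(2)[OF g] assms(3)
    by (simp add: set_lebesgue_integral_def)
  then have "AE x in lebesgue. indicat_real S x *\<^sub>R g x = 0"
    using g assms(2)
    by (subst (asm) integral_nonneg_eq_0_iff_AE) (auto simp: set_integrable_def indicator_def)
  moreover have "(\<lambda>x. indicat_real S x *\<^sub>R g x) \<in> borel_measurable lebesgue"
    using g unfolding set_integrable_def by (rule borel_measurable_integrable)
  then have "{x \<in> space lebesgue. indicat_real S x *\<^sub>R g x \<noteq> 0} \<in> sets lebesgue"
    by measurable
  ultimately have "{x \<in> space lebesgue. indicat_real S x *\<^sub>R g x \<noteq> 0} \<in> null_sets lebesgue"
    by (subst (asm) AE_iff_null)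
  moreover have "{x \<in> space lebesgue. indicat_real S x *\<^sub>R g x \<noteq> 0} = {x \<in> S. g x \<noteq> 0}"
    by (auto simp: indicator_def)
  ultimately show ?thesis
    by (simp add: negligible_iff_null_sets)
qed

section \<open>Growth of the error norm, and its continuation once it reaches
  \<open>\<rho>\<close>\<close>

theorem proposition3p2:
  fixes scaleH :: "'k::{real_normed_field,real_inner} \<Rightarrow> 'h::banach \<Rightarrow> 'h"
    and ipH :: "'h \<Rightarrow> 'h \<Rightarrow> 'k"
    and scaleQ :: "'l::{real_normed_field,real_inner} \<Rightarrow> 'q::real_normed_vector \<Rightarrow> 'q"
    and ipQ :: "'q \<Rightarrow> 'q \<Rightarrow> 'l"
    and \<Phi> :: "'q \<Rightarrow> 'h" and \<Phi>' :: "'q \<Rightarrow> 'q \<Rightarrow>\<^sub>L 'h"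
    and f :: "'h \<Rightarrow> 'h" and y y' :: "real \<Rightarrow> 'h" and \<theta> :: "real \<Rightarrow> 'q"
    and \<epsilon> :: "real \<Rightarrow> real" and l L T \<rho> t :: real
  defines "bound \<equiv> exp ((l + L) * t) * norm (\<Phi> (\<theta> 0) - y 0)
      + exp ((l + L) * t) * integral {0..t} (approximability \<Phi> \<Phi>' \<epsilon> y y' \<rho>)"
  assumes H: "hilbert_space scaleH ipH"
    and Q: "finite_dim_inner_product_space scaleQ ipQ"
    and Phi: "twice_continuously_differentiable \<Phi> \<Phi>'"
    and eps_pos: "\<And>s. s \<in> {0..T} \<Longrightarrow> \<epsilon> s > 0"
    and eps_cont: "continuous_on {0..T} \<epsilon>"
    and one_sided: "\<And>v w. scalar_Re (ipH (v - w) (f v - f w)) \<le> l * (norm (v - w))\<^sup>2"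
    and lipschitz: "\<And>v w. norm (f v - f w) \<le> L * norm (v - w)"
    and y_deriv: "\<And>s. s \<in> {0..T} \<Longrightarrow> (y has_vector_derivative y' s) (at s within {0..T})"
    and y_ode: "\<And>s. s \<in> {0..T} \<Longrightarrow> y' s = f (y s)"
    and approx: "regularized_dynamical_approximation \<Phi> \<Phi>' f \<epsilon> T \<theta>"
    and rho_pos: "\<rho> > 0"
    and rho_approx: "\<And>s. s \<in> {0..T} \<Longrightarrow> \<exists>\<eta>. norm (\<Phi> \<eta> - y s) \<le> \<rho>"
    and integrable: "approximability \<Phi> \<Phi>' \<epsilon> y y' \<rho> integrable_on {0..T}"
    and t: "t \<in> {0..T}"
    and bound_le: "bound \<le> \<rho>"
  shows "norm (\<Phi> (\<theta> t) - y t) \<le> bound"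
proof -
  interpret hilbert_space scaleH ipH
    by (rule H)
  let ?\<delta> = "approximability \<Phi> \<Phi>' \<epsilon> y y' \<rho>"
  let ?\<kappa> = "l + L"
  define e where "e s = \<Phi> (\<theta> s) - y s" for s
  have \<delta>_nonneg: "0 \<le> ?\<delta> s" if "s \<in> {0..T}" for s
    using rho_approx[OF that] approximability_nonneg by blast
  have \<delta>_int: "?\<delta> integrable_on {a..b}" if "0 \<le> a" "b \<le> T" for a b
    using that by (intro integrable_on_subinterval[OF integrable]) auto
  have int_nonneg: "0 \<le> integral {a..b} ?\<delta>" if "0 \<le> a" "b \<le> T" for a b
    using that \<delta>_nonneg \<delta>_int by (intro integral_nonneg) auto
  show ?thesis
  \<comment> \<open>The sign of \<open>l + L\<close> comes from testing both conditions on
    \<open>f\<close> with a nonzero vector, so the trivial space is settled separately.\<close>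
  proof (cases "\<forall>v :: 'h. v = 0")
    case True
    then have "norm (\<Phi> (\<theta> t) - y t) = 0"
      by (metis norm_zero)
    also have "0 \<le> bound"
      unfolding bound_def using t by (intro add_nonneg_nonneg mult_nonneg_nonneg int_nonneg) auto
    finally show ?thesis .
  next
    case False
    then obtain v :: 'h where v: "v \<noteq> 0"
      by blast
    have "\<bar>re_ip v (f v - f 0)\<bar> \<le> norm v * (L * norm v)"
      using lipschitz[of v 0] by (intro order_trans[OF abs_re_ip_le mult_left_mono]) auto
    moreover have "re_ip v (f v - f 0) \<le> l * (norm v)\<^sup>2"
      using one_sided[of v 0] by (simp add: re_ip_def)
    ultimately have "0 \<le> ?\<kappa> * (norm v)\<^sup>2"
      by (simp add: power2_eq_square algebra_simps)
    then have \<kappa>: "0 \<le> ?\<kappa>"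
      using v by (simp add: zero_le_mult_iff)
    obtain \<theta>' where \<theta>': "\<And>s. s \<in> {0..T} \<Longrightarrow> (\<theta> has_vector_derivative \<theta>' s) (at s within {0..T})"
      and min: "\<And>s. s \<in> {0..T} \<Longrightarrow>
        unique_minimizer (regularized_residual (\<Phi>' (\<theta> s)) (f (\<Phi> (\<theta> s))) (\<epsilon> s)) (\<theta>' s)"
      using approx unfolding regularized_dynamical_approximation_def by blast
    define e' where "e' s = blinfun_apply (\<Phi>' (\<theta> s)) (\<theta>' s) - y' s" for s
    have e_deriv: "(e has_vector_derivative e' s) (at s within {0..T})" if s: "s \<in> {0..T}" for s
    proof -
      have "(\<Phi> has_derivative blinfun_apply (\<Phi>' (\<theta> s))) (at (\<theta> s) within \<theta> ` {0..T})"
        using Phi unfolding twice_continuously_differentiable_def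
        by (blast intro: has_derivative_at_withinI)
      from vector_derivative_diff_chain_within[OF \<theta>'[OF s] this] y_deriv[OF s]
      show ?thesis
        unfolding e_def e'_def o_def by (rule has_vector_derivative_diff)
    qed
    have growth: "re_ip (e s) (e' s) \<le> ?\<kappa> * (norm (e s))\<^sup>2 + ?\<delta> s * norm (e s)"
      if s: "s \<in> {0..T}" and *: "norm (e s) \<le> \<rho> \<or> ?\<delta> s = 0" for s
    proof -
      let ?d = "blinfun_apply (\<Phi>' (\<theta> s)) (\<theta>' s) - f (\<Phi> (\<theta> s))"
      obtain \<theta>\<^sub>0 where \<theta>\<^sub>0: "norm (\<Phi> \<theta>\<^sub>0 - y s) \<le> \<rho>"
        using rho_approx s by blast
      have "norm ?d \<le> ?\<delta> s + norm (f (\<Phi> (\<theta> s)) - y' s)"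
        using minimal_residual_le[where \<Phi> = \<Phi> and \<Phi>' = \<Phi>' and \<epsilon> = \<epsilon> and y = y
            and \<theta> = "\<theta> s" and s = s, OF min[OF s] eps_pos[OF s] \<theta>\<^sub>0] *
        by (auto simp: e_def)
      also have "\<dots> \<le> ?\<delta> s + L * norm (e s)"
        using lipschitz[of "\<Phi> (\<theta> s)" "y s"] y_ode[OF s] by (simp add: e_def)
      finally have "re_ip (e s) ?d \<le> norm (e s) * (?\<delta> s + L * norm (e s))"
        by (rule order_trans[OF re_ip_le mult_left_mono]) simp
      moreover have "re_ip (e s) (f (\<Phi> (\<theta> s)) - f (y s)) \<le> l * (norm (e s))\<^sup>2"
        using one_sided by (simp add: re_ip_def e_def)
      \<comment> \<open>Inserting \<open>f (\<Phi> (\<theta> s))\<close> separates the projection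
        defect, contributing \<open>?\<delta>\<close> and \<open>L\<close>, from the one-sided
        Lipschitz part, contributing \<open>l\<close>.\<close>
      moreover have "re_ip (e s) (e' s) = re_ip (e s) ?d + re_ip (e s) (f (\<Phi> (\<theta> s)) - f (y s))"
        by (simp add: e'_def y_ode[OF s] flip: re_ip_add_right)
      ultimately show ?thesis
        by (simp add: algebra_simps power2_eq_square)
    qed
    have gronwall: "exp (- ?\<kappa> * b) * norm (e b) \<le> exp (- ?\<kappa> * a) * norm (e a) + integral {a..b} ?\<delta>"
      if ab: "0 \<le> a" "a \<le> b" "b \<le> T" and N: "negligible N"
        and *: "\<And>s. s \<in> {a..b} - N \<Longrightarrow> norm (e s) \<le> \<rho> \<or> ?\<delta> s = 0" for a b N
    proof (rule norm_gronwall[OF ab(1,2) \<kappa> _ N])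
      show "(e has_vector_derivative e' s) (at s within {a..b})" if "s \<in> {a..b}" for s
        using that ab by (intro has_vector_derivative_within_subset[OF e_deriv]) auto
    qed (use ab * in \<open>auto intro!: growth \<delta>_nonneg \<delta>_int\<close>)
    have exp_cancel: "exp (k * s) * (exp (- k * s) * x) = x" for k s x :: real
      by (simp add: exp_minus)
    \<comment> \<open>\<open>F\<close> is the bound without its exponential factor; it is
      nondecreasing on \<open>{0..T}\<close>.\<close>
    define F where "F s = norm (e 0) + integral {0..s} ?\<delta>" for s
    have bound_eq: "bound = exp (?\<kappa> * t) * F t"
      by (simp add: bound_def F_def e_def distrib_left)
    have F_split: "F t = F m + integral {m..t} ?\<delta>" if "0 \<le> m" "m \<le> t" for m
      using that t Henstock_Kurzweil_Integration.integral_combine[OF that \<delta>_int] by (simp add: F_def)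
    have "exp (- ?\<kappa> * t) * norm (e t) \<le> F t"
    proof (cases "\<forall>s\<in>{0..t}. norm (e s) < \<rho>")
      case True
      then show ?thesis
        using gronwall[of 0 t "{}"] t by (force simp: F_def)
    next
      case False
      have "continuous_on {0..T} e"
        using e_deriv has_vector_derivative_continuous continuous_on_eq_continuous_within by blast
      then have cont: "continuous_on {0..t} (\<lambda>s. norm (e s))"
        using t by (auto intro: continuous_on_norm continuous_on_subset)
      let ?M = "{s \<in> {0..t}. \<rho> \<le> norm (e s)}"
      have "compact ?M"
        unfolding compact_eq_bounded_closed
        by (intro conjI bounded_subset[of "{0..t}" ?M]
            continuous_on_closed_Collect_le[OF continuous_on_const cont]) auto
      moreover have "?M \<noteq> {}"
        using False by (auto simp: not_less)
      ultimately obtain m where m: "m \<in> ?M" and m_le: "\<And>s. s \<in> ?M \<Longrightarrow> m \<le> s"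
        using compact_attains_inf by meson
      have m': "0 \<le> m" "m \<le> t" "t \<le> T" "\<rho> \<le> norm (e m)"
        using m t by auto
      \<comment> \<open>At \<open>m\<close> itself only \<open>\<rho> \<le> norm (e m)\<close> is
        recorded, so this point goes into the exceptional set; this also covers
        \<open>m = 0\<close>.\<close>
      have "norm (e s) \<le> \<rho>" if "s \<in> {0..m} - {m}" for s
        using m_le[of s] that m' by force
      then have m_bound: "exp (- ?\<kappa> * m) * norm (e m) \<le> F m"
        using gronwall[of 0 m "{m}"] m' by (auto simp: F_def)
      have "\<rho> \<le> exp (?\<kappa> * m) * (exp (- ?\<kappa> * m) * norm (e m))"
        using m'(4) by (simp only: exp_cancel)
      also have "\<dots> \<le> exp (?\<kappa> * m) * F m"
        using m_bound by (rule mult_left_mono) simp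
      also have "\<dots> \<le> exp (?\<kappa> * t) * F m"
        using \<kappa> m' int_nonneg[of 0 m]
        by (intro mult_right_mono) (auto simp: F_def mult_left_mono)
      \<comment> \<open>The chain runs from \<open>\<rho>\<close> up to
        \<open>exp (?\<kappa> * t) * F m\<close>, while the bound at \<open>t\<close> is at most
        \<open>\<rho>\<close>; hence \<open>F\<close> cannot grow on \<open>{m..t}\<close>.\<close>
      finally have "exp (?\<kappa> * t) * F t \<le> exp (?\<kappa> * t) * F m"
        using bound_le bound_eq by linarith
      then have int_0: "integral {m..t} ?\<delta> = 0"
        using F_split[OF m'(1,2)] int_nonneg[OF m'(1,3)] by simp
      then have "negligible {s \<in> {m..t}. ?\<delta> s \<noteq> 0}"
        using m' \<delta>_nonneg \<delta>_int by (intro negligible_nonzero_set_if_integral_eq_0) auto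
      \<comment> \<open>Past \<open>m\<close> the alternative \<open>?\<delta> s = 0\<close> of
        \<open>gronwall\<close> is used off a null set, so no bound of the error by
        \<open>\<rho>\<close> enters.\<close>
      then have "exp (- ?\<kappa> * t) * norm (e t) \<le> exp (- ?\<kappa> * m) * norm (e m)"
        using gronwall[of m t] m' int_0 by fastforce
      with m_bound int_0 F_split[OF m'(1,2)] show ?thesis
        by linarith
    qed
    then have "exp (?\<kappa> * t) * (exp (- ?\<kappa> * t) * norm (e t)) \<le> bound"
      unfolding bound_eq by (rule mult_left_mono) simp
    then show ?thesis
      by (simp only: exp_cancel e_def)
  qed
qed

end
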